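(* Let $W\ge 1$ be an integer and $0<\varepsilon<1$ be such that $W\varepsilon^{-1}=2^L$ for an integer $L$. Consider a window consisting of the last $W$ items of a stream over a universe of IDs; for an ID $y$ let $f^W_y$ be its number of occurrences in the window, and let $\mathcal D$ be the set of distinct IDs in the window. Let $h$ be a random fingerprint function mapping IDs to $\{0,1,\dots,2^L-1\}$ such that the fingerprints of distinct IDs are independent and uniformly distributed; let $F=\{h(y):y\in\mathcal D\}$ and for $g\in F$ let $n_g$ be the number of items in the window whose fingerprint is $g$. Define $$H=-\sum_{y\in\mathcal D}\frac{f^W_y}{W}\ln\frac{f^W_y}{W},\qquad \hat H=-\sum_{g\in F}\frac{n_g}{W}\ln\frac{n_g}{W}.$$ Then $\hat H\le H$ always, and $\mathbb{E}(\hat H)\ge H-\varepsilon$.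
   Context: $H$ is the entropy of the window's ID distribution and $\hat H$ is the estimator maintained and returned by the Entropy query of the SWAMP algorithm (entropy of the fingerprint distribution in the window). *)

theory Defs
  imports "HOL-Probability.Probability"
begin

text \<open>A stream is given by the list of the items received so far, most recent item last.
  The definition is meaningful only if at least \<open>W\<close> items have been received.\<close>

definition window :: "nat \<Rightarrow> 'a list \<Rightarrow> 'a list" where
  "window W s = drop (length s - W) s"

definition window_freq :: "nat \<Rightarrow> 'a list \<Rightarrow> 'a \<Rightarrow> nat" where
  "window_freq W s y = count_list (window W s) y"

definition window_ids :: "nat \<Rightarrow> 'a list \<Rightarrow> 'a set" where
  "window_ids W s = set (window W s)"

definition window_entropy :: "nat \<Rightarrow> 'a list \<Rightarrow> real" where
  "window_entropy W s =
     - (\<Sum>y\<in>window_ids W s.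
          real (window_freq W s y) / real W * ln (real (window_freq W s y) / real W))"

definition fingerprint_count :: "nat \<Rightarrow> 'a list \<Rightarrow> ('a \<Rightarrow> nat) \<Rightarrow> nat \<Rightarrow> nat" where
  "fingerprint_count W s h g = length (filter (\<lambda>y. h y = g) (window W s))"

definition entropy_estimate :: "nat \<Rightarrow> 'a list \<Rightarrow> ('a \<Rightarrow> nat) \<Rightarrow> real" where
  "entropy_estimate W s h =
     - (\<Sum>g\<in>h ` window_ids W s.
          real (fingerprint_count W s h g) / real W * ln (real (fingerprint_count W s h g) / real W))"

end

theory Submission
  imports Defs
begin

text \<open>Grouping the items by their IDs gives
  \<open>H - H' = (\<Sum>y. f\<^sub>y/W * ln (n(h y)/f\<^sub>y))\<close>, where \<open>H'\<close> is the estimate. All terms are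
  nonnegative, since \<open>n(h y) \<ge> f\<^sub>y\<close>. By \<open>ln x \<le> x - 1\<close> the term of \<open>y\<close> is at most \<open>1/W\<close> times
  the number of items with another ID whose fingerprint collides with that of \<open>y\<close>. Two distinct IDs
  collide with probability \<open>2\<^sup>-\<^sup>L = \<epsilon>/W\<close>, and there are at most \<open>W\<close> IDs, so
  the expected loss is at most \<open>\<epsilon>\<close>.\<close>

lemma length_filter_eq_sum_count_list:
  "length (filter P xs) = (\<Sum>y\<in>set xs. if P y then count_list xs y else 0)"
proof -
  have "count_list (filter P xs) y = (if P y then count_list xs y else 0)" for y
    by (induction xs) auto
  moreover have "length (filter P xs) = sum (count_list (filter P xs)) (set xs)"
    by (rule sum_count_set[symmetric]) auto
  ultimately show ?thesis by simp
qed

lemma finite_window_ids [simp]: "finite (window_ids W s)"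
  by (simp add: window_ids_def)

lemma window_freq_pos: "y \<in> window_ids W s \<Longrightarrow> window_freq W s y > 0"
  by (simp add: window_ids_def window_freq_def count_list_0_iff zero_less_iff_neq_zero)

text \<open>The subtraction in \<open>window\<close> is truncated: a stream shorter than
  \<open>W\<close> would be its own window, and the frequencies would fall short of
  \<open>W\<close>.\<close>

lemma sum_window_freq:
  "length s \<ge> W \<Longrightarrow> (\<Sum>y\<in>window_ids W s. window_freq W s y) = W"
  unfolding window_freq_def window_ids_def by (subst sum_count_set) (auto simp: window_def)

lemma card_window_ids_le: "length s \<ge> W \<Longrightarrow> card (window_ids W s) \<le> W"
  using card_length[of "window W s"] by (simp add: window_ids_def window_def)

lemma fingerprint_count_eq_sum:
  "fingerprint_count W s h g =
     (\<Sum>y\<in>window_ids W s. if h y = g then window_freq W s y else 0)"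
  unfolding fingerprint_count_def window_freq_def window_ids_def
  by (rule length_filter_eq_sum_count_list)

text \<open>Separates the occurrences of \<open>y\<close> itself from those of the IDs that collide
  with it; the second summand is what the bound on the loss charges to \<open>y\<close>.\<close>

lemma fingerprint_count_split:
  assumes "y \<in> window_ids W s"
  shows "fingerprint_count W s h (h y) = window_freq W s y +
           (\<Sum>z\<in>window_ids W s - {y}. if h z = h y then window_freq W s z else 0)"
  unfolding fingerprint_count_eq_sum using assms by (subst sum.remove[of _ y]) auto

lemma window_freq_le_fingerprint_count:
  "y \<in> window_ids W s \<Longrightarrow> window_freq W s y \<le> fingerprint_count W s h (h y)"
  by (simp add: fingerprint_count_split)

text \<open>The logarithm is constant on each fibre of \<open>h\<close>, and the frequencies over
  the fibre of \<open>g\<close> add up to the count of \<open>g\<close>. The new index set does not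
  depend on \<open>h\<close>, so the estimate can be compared with the entropy term by term, and its
  measurability in \<open>h\<close> becomes accessible.\<close>

lemma entropy_estimate_eq:
  "entropy_estimate W s h = - (\<Sum>y\<in>window_ids W s.
     real (window_freq W s y) / real W * ln (real (fingerprint_count W s h (h y)) / real W))"
proof -
  let ?D = "window_ids W s"
  let ?n = "\<lambda>g. real (fingerprint_count W s h g)"
  have "(\<Sum>y\<in>?D. real (window_freq W s y) / real W * ln (?n (h y) / real W)) =
    (\<Sum>g\<in>h ` ?D. \<Sum>y | y \<in> ?D \<and> h y = g. real (window_freq W s y) / real W * ln (?n (h y) / real W))"
    by (rule sum.image_gen) simp
  also have "\<dots> = (\<Sum>g\<in>h ` ?D. ?n g / real W * ln (?n g / real W))"
  proof (rule sum.cong[OF refl])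
    fix g
    have "?n g = (\<Sum>y | y \<in> ?D \<and> h y = g. real (window_freq W s y))"
      by (simp add: fingerprint_count_eq_sum sum.inter_filter if_distrib[of real] cong: if_cong)
    then show "(\<Sum>y | y \<in> ?D \<and> h y = g. real (window_freq W s y) / real W * ln (?n (h y) / real W))
        = ?n g / real W * ln (?n g / real W)"
      by (simp add: sum_distrib_right sum_divide_distrib)
  qed
  finally show ?thesis by (simp add: entropy_estimate_def)
qed

lemma entropy_loss_eq:
  assumes "W \<ge> 1"
  shows "window_entropy W s - entropy_estimate W s h = (\<Sum>y\<in>window_ids W s.
     real (window_freq W s y) / real W *
       ln (real (fingerprint_count W s h (h y)) / real (window_freq W s y)))"
proof -
  have "window_entropy W s - entropy_estimate W s h = (\<Sum>y\<in>window_ids W s.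
     real (window_freq W s y) / real W * ln (real (fingerprint_count W s h (h y)) / real W) -
     real (window_freq W s y) / real W * ln (real (window_freq W s y) / real W))"
    by (simp add: window_entropy_def entropy_estimate_eq sum_subtractf)
  also have "\<dots> = (\<Sum>y\<in>window_ids W s. real (window_freq W s y) / real W *
       ln (real (fingerprint_count W s h (h y)) / real (window_freq W s y)))"
  proof (rule sum.cong[OF refl])
    fix y assume y: "y \<in> window_ids W s"
    \<comment> \<open>Positivity lets both logarithms of quotients split, after which the two copies
      of \<open>ln W\<close> cancel.\<close>
    have "real (window_freq W s y) > 0" "real (fingerprint_count W s h (h y)) > 0" "real W > 0"
      using window_freq_pos[OF y] window_freq_le_fingerprint_count[OF y, of h] assms by auto
    then show "real (window_freq W s y) / real W * ln (real (fingerprint_count W s h (h y)) / real W) -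
     real (window_freq W s y) / real W * ln (real (window_freq W s y) / real W) =
     real (window_freq W s y) / real W *
       ln (real (fingerprint_count W s h (h y)) / real (window_freq W s y))"
      by (simp only: right_diff_distrib[symmetric] ln_div) simp
  qed
  finally show ?thesis .
qed

lemma entropy_loss_nonneg:
  assumes "W \<ge> 1"
  shows "entropy_estimate W s h \<le> window_entropy W s"
proof -
  have "0 \<le> window_entropy W s - entropy_estimate W s h"
    unfolding entropy_loss_eq[OF assms]
  proof (rule sum_nonneg)
    fix y assume y: "y \<in> window_ids W s"
    have "1 \<le> real (fingerprint_count W s h (h y)) / real (window_freq W s y)"
      using window_freq_pos[OF y] window_freq_le_fingerprint_count[OF y, of h] by simp
    then show "0 \<le> real (window_freq W s y) / real W *
        ln (real (fingerprint_count W s h (h y)) / real (window_freq W s y))"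
      by simp
  qed
  then show ?thesis by simp
qed

lemma entropy_loss_le_collisions:
  assumes "W \<ge> 1"
  shows "window_entropy W s - entropy_estimate W s h \<le>
    (\<Sum>y\<in>window_ids W s. \<Sum>z\<in>window_ids W s - {y}.
       real (window_freq W s z) / real W * of_bool (h z = h y))"
  unfolding entropy_loss_eq[OF assms]
proof (rule sum_mono)
  fix y assume y: "y \<in> window_ids W s"
  let ?f = "real (window_freq W s y)" and ?n = "real (fingerprint_count W s h (h y))"
  let ?c = "\<Sum>z\<in>window_ids W s - {y}. real (window_freq W s z) * of_bool (h z = h y)"
  have pos: "?f > 0" "?n > 0"
    using window_freq_pos[OF y] window_freq_le_fingerprint_count[OF y, of h] by auto
  have n: "?n = ?f + ?c"
    unfolding fingerprint_count_split[OF y] of_nat_add of_nat_sum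
    by (intro arg_cong2[where f = "(+)"] sum.cong) auto
  \<comment> \<open>The factor \<open>?f\<close> in front cancels the denominator, so the linear
    bound leaves only the excess \<open>?n - ?f = ?c\<close>.\<close>
  have "?f / real W * ln (?n / ?f) \<le> ?f / real W * (?n / ?f - 1)"
    using pos by (intro mult_left_mono ln_le_minus_one) auto
  also have "\<dots> = ?c / real W"
    using pos unfolding n by (simp add: field_simps)
  also have "\<dots> = (\<Sum>z\<in>window_ids W s - {y}.
      real (window_freq W s z) / real W * of_bool (h z = h y))"
    by (simp add: sum_divide_distrib del: sum_mult_of_bool_eq)
  finally show "?f / real W * ln (?n / ?f) \<le> \<dots>" .
qed

text \<open>Since \<open>X\<close> takes values below \<open>n\<close>, a collision happens at one
  of finitely many common values. This decomposition yields both the measurability and the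
  probability of the event.\<close>

lemma collision_event_eq:
  assumes "X \<in> measurable M (count_space {0..<n::nat})"
  shows "{\<omega> \<in> space M. X \<omega> = Y \<omega>} =
    (\<Union>g\<in>{0..<n}. (X -` {g} \<inter> space M) \<inter> (Y -` {g} \<inter> space M))"
  using measurable_space[OF assms] by fastforce

lemma sets_collision:
  assumes "X \<in> measurable M (count_space {0..<n::nat})" "Y \<in> measurable M (count_space {0..<n})"
  shows "{\<omega> \<in> space M. X \<omega> = Y \<omega>} \<in> sets M"
  unfolding collision_event_eq[OF assms(1)]
  using assms by (intro sets.finite_UN sets.Int[OF measurable_sets measurable_sets] assms) auto

text \<open>Both variables hit a given value with probability \<open>1/n^2\<close> by independence
  and uniformity, and the \<open>n\<close> possible values give disjoint events.\<close>

lemma (in prob_space) prob_collision: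
  assumes ind: "indep_vars (\<lambda>_. count_space {0..<n::nat}) X I"
    and unif: "\<And>i. i \<in> I \<Longrightarrow>
      distr M (count_space {0..<n}) (X i) = uniform_count_measure {0..<n}"
    and ij: "i \<in> I" "j \<in> I" "i \<noteq> j"
  shows "prob {\<omega> \<in> space M. X i \<omega> = X j \<omega>} = 1 / real n"
proof -
  have meas: "X k \<in> measurable M (count_space {0..<n})" if "k \<in> I" for k
    using ind that by (auto simp: indep_vars_def)
  have single: "prob (X k -` {g} \<inter> space M) = 1 / real n" if "k \<in> I" "g < n" for k g
  proof -
    have "prob (X k -` {g} \<inter> space M) = measure (distr M (count_space {0..<n}) (X k)) {g}"
      using meas[OF that(1)] that(2) by (subst measure_distr) auto
    also have "\<dots> = 1 / real n"
      using that by (simp add: unif measure_uniform_count_measure)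
    finally show ?thesis .
  qed
  have pair: "prob ((X i -` {g} \<inter> space M) \<inter> (X j -` {g} \<inter> space M)) = (1 / real n)\<^sup>2"
    if "g < n" for g
  proof -
    have "prob (\<Inter>k\<in>{i, j}. X k -` {g} \<inter> space M) = (\<Prod>k\<in>{i, j}. prob (X k -` {g} \<inter> space M))"
      using that ij by (intro indep_varsD[OF ind]) auto
    then show ?thesis
      using ij that by (simp add: single power2_eq_square)
  qed
  have "prob {\<omega> \<in> space M. X i \<omega> = X j \<omega>} =
      (\<Sum>g\<in>{0..<n}. prob ((X i -` {g} \<inter> space M) \<inter> (X j -` {g} \<inter> space M)))"
    unfolding collision_event_eq[OF meas[OF ij(1)]]
    using meas ij
    by (intro finite_measure_finite_Union)
       (auto simp: disjoint_family_on_def intro!: sets.Int measurable_sets)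
  also have "\<dots> = 1 / real n"
    by (simp add: pair power2_eq_square)
  finally show ?thesis .
qed

theorem theorem17:
  fixes W L :: nat
    and \<epsilon> :: real
    and s :: "'a list"
    and M :: "'w measure"
    and h :: "'w \<Rightarrow> 'a \<Rightarrow> nat"
  assumes "W \<ge> 1"
    and "0 < \<epsilon>" and "\<epsilon> < 1"
    and "real W * inverse \<epsilon> = 2 ^ L"
    and "length s \<ge> W"
    and "prob_space M"
    and "prob_space.indep_vars M (\<lambda>_. count_space {0..<2 ^ L}) (\<lambda>y \<omega>. h \<omega> y) UNIV"
    and "\<And>y. distr M (count_space {0..<2 ^ L}) (\<lambda>\<omega>. h \<omega> y) = uniform_count_measure {0..<2 ^ L}"
  shows "(\<forall>\<omega>\<in>space M. entropy_estimate W s (h \<omega>) \<le> window_entropy W s) \<and>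
         (\<integral>\<omega>. entropy_estimate W s (h \<omega>) \<partial>M) \<ge> window_entropy W s - \<epsilon>"
proof
  show "\<forall>\<omega>\<in>space M. entropy_estimate W s (h \<omega>) \<le> window_entropy W s"
    using entropy_loss_nonneg[OF assms(1)] by blast
next
  interpret prob_space M by fact
  let ?D = "window_ids W s" and ?f = "\<lambda>y. real (window_freq W s y)"
  define C where "C y z = {\<omega> \<in> space M. h \<omega> y = h \<omega> z}" for y z
  \<comment> \<open>The bound of \<open>entropy_loss_le_collisions\<close> as a random variable;
    with indicators, its expectation is a combination of collision probabilities.\<close>
  define B where "B \<omega> = (\<Sum>y\<in>?D. \<Sum>z\<in>?D - {y}. ?f z / real W * indicator (C z y) \<omega>)" for \<omega>
  define loss where "loss \<omega> = window_entropy W s - entropy_estimate W s (h \<omega>)" for \<omega>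
  have meas: "(\<lambda>\<omega>. h \<omega> y) \<in> measurable M (count_space {0..<2 ^ L})" for y
    using assms(7) by (auto simp: indep_vars_def)
  have C [measurable]: "C y z \<in> sets M" for y z
    unfolding C_def by (rule sets_collision[OF meas meas])
  have prob_C: "prob (C y z) = \<epsilon> / real W" if "y \<noteq> z" for y z
  proof -
    have "prob (C y z) = 1 / real (2 ^ L)"
      unfolding C_def using assms(7,8) that by (intro prob_collision[where I = UNIV]) auto
    also have "\<dots> = \<epsilon> / real W"
      by (simp flip: assms(4) add: field_simps)
    finally show ?thesis .
  qed
  have integrable_ind: "integrable M (\<lambda>\<omega>. c * indicator (C y z) \<omega>)" for c :: real and y z
    by (intro integrable_mult_right integrable_real_indicator) (auto simp: emeasure_eq_measure)
  have B_integrable: "integrable M B"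
    unfolding B_def by (intro Bochner_Integration.integrable_sum integrable_ind)
  have loss_bounds: "0 \<le> loss \<omega>" "loss \<omega> \<le> B \<omega>" if "\<omega> \<in> space M" for \<omega>
  proof -
    show "0 \<le> loss \<omega>"
      using entropy_loss_nonneg[OF assms(1)] by (simp add: loss_def)
    show "loss \<omega> \<le> B \<omega>"
      using entropy_loss_le_collisions[OF assms(1), of s "h \<omega>"] that
      by (simp add: loss_def B_def C_def indicator_def of_bool_def)
  qed
  have loss_measurable: "loss \<in> borel_measurable M"
  proof -
    \<comment> \<open>Only the single fingerprints \<open>h \<omega> y\<close> are known to be
      measurable, not \<open>h\<close> as a function-valued map. The loss is therefore written as a
      finite expression in indicators of the events \<open>C z y\<close>.\<close>
    have "(\<lambda>\<omega>. window_entropy W s + (\<Sum>y\<in>?D. ?f y / real W *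
        ln ((\<Sum>z\<in>?D. ?f z * indicator (C z y) \<omega>) / real W))) \<in> borel_measurable M"
      by measurable
    moreover have "loss \<omega> = window_entropy W s + (\<Sum>y\<in>?D. ?f y / real W *
        ln ((\<Sum>z\<in>?D. ?f z * indicator (C z y) \<omega>) / real W))" if "\<omega> \<in> space M" for \<omega>
    proof -
      have "real (fingerprint_count W s (h \<omega>) (h \<omega> y)) = (\<Sum>z\<in>?D. ?f z * indicator (C z y) \<omega>)" for y
        unfolding fingerprint_count_eq_sum of_nat_sum
        using that by (intro sum.cong) (auto simp: C_def indicator_def)
      then show ?thesis by (simp add: loss_def entropy_estimate_eq)
    qed
    ultimately show ?thesis by (subst measurable_cong) auto
  qed
  \<comment> \<open>The loss lies between 0 and the integrable \<open>B\<close>. Integrability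
    matters because the integral of a non-integrable function is 0 by convention.\<close>
  have loss_integrable: "integrable M loss"
    using loss_bounds by (intro Bochner_Integration.integrable_bound[OF B_integrable loss_measurable])
      (fastforce intro!: AE_I2)
  have "expectation loss \<le> expectation B"
    using loss_bounds by (intro integral_mono loss_integrable B_integrable)
  also have "\<dots> = (\<Sum>y\<in>?D. \<Sum>z\<in>?D - {y}. ?f z / real W * prob (C z y))"
    unfolding B_def by (simp only: Bochner_Integration.integral_sum Bochner_Integration.integrable_sum
        integrable_ind integral_mult_right_zero Bochner_Integration.integral_indicator sets.Int_space_eq2 C)
  also have "\<dots> = (\<Sum>y\<in>?D. \<Sum>z\<in>?D - {y}. ?f z / real W * (\<epsilon> / real W))"
    by (intro sum.cong refl) (auto simp: prob_C)
  \<comment> \<open>Adding the nonnegative diagonal terms \<open>z = y\<close> completes the inner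
    sum of frequencies to \<open>W\<close>, so each ID contributes exactly
    \<open>\<epsilon> / W\<close>.\<close>
  also have "\<dots> \<le> (\<Sum>y\<in>?D. \<Sum>z\<in>?D. ?f z / real W * (\<epsilon> / real W))"
    using assms(2) by (intro sum_mono sum_mono2) auto
  also have "\<dots> = real (card ?D) * (\<epsilon> / real W)"
    using assms(1) sum_window_freq[OF assms(5)]
    by (simp flip: sum_distrib_right sum_divide_distrib of_nat_sum)
  also have "\<dots> \<le> real W * (\<epsilon> / real W)"
    using card_window_ids_le[OF assms(5)] assms(2) by (intro mult_right_mono) auto
  finally have "expectation loss \<le> \<epsilon>"
    using assms(1) by simp
  moreover have "(\<integral>\<omega>. entropy_estimate W s (h \<omega>) \<partial>M) = (\<integral>\<omega>. window_entropy W s - loss \<omega> \<partial>M)"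
    by (simp add: loss_def)
  moreover have "\<dots> = window_entropy W s - expectation loss"
    using loss_integrable by (simp add: prob_space)
  ultimately show "(\<integral>\<omega>. entropy_estimate W s (h \<omega>) \<partial>M) \<ge> window_entropy W s - \<epsilon>"
    by simp
qed

end
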